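(* Let $\ell$ be a positive integer. Every digraph $D$ with $\delta^+(D) \geq 2$ and digirth at least $2\ell$ contains a copy of $S^{+(\ell)}_2$.
   Context: Digraphs are finite, without loops or parallel arcs. $\delta^+(D)$ is the minimum out-degree. The digirth is the length of a shortest directed cycle ($+\infty$ if acyclic). $S_2^{+(\ell)}$ is the digraph consisting of two directed paths of length $\ell$ (i.e. $\ell$ arcs) sharing their initial vertex and no other vertices. A copy of it in $D$ is a subdigraph of $D$ isomorphic to it. *)

theory Defs
  imports "Graph_Theory.Graph_Theory" "HOL-Library.Extended_Nat"
begin

text \<open>Meaningful for finite digraphs with at least one vertex; \<^term>\<open>Min {}\<close> is unspecified.\<close>

definition min_out_degree :: "('a,'b) pre_digraph \<Rightarrow> nat" where
  "min_out_degree D = Min (out_degree D ` verts D)"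

text \<open>
  Cycles are lists of arcs, so \<^const>\<open>length\<close> counts arcs; a pair of opposite arcs forms a cycle of
  length 2. For acyclic digraphs the infimum is that of the empty set, i.e. \<^term>\<open>\<infinity> :: enat\<close>.
\<close>

definition digirth :: "('a,'b) pre_digraph \<Rightarrow> enat" where
  "digirth D = (INF p \<in> {p. pre_digraph.cycle D p}. enat (length p))"

text \<open>
  The vertex 0 is the common initial vertex of the directed paths
  \<open>0, 1, \<dots>, l\<close> and \<open>0, -1, \<dots>, -l\<close>.
\<close>

definition out_spider2 :: "nat \<Rightarrow> (int, int \<times> int) pre_digraph" where
  "out_spider2 l = \<lparr> verts = {- int l..int l},
     arcs = {(i, i + 1) | i. 0 \<le> i \<and> i < int l} \<union> {(- i, - (i + 1)) | i. 0 \<le> i \<and> i < int l},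
     tail = fst, head = snd \<rparr>"

definition contains_copy :: "('a,'b) pre_digraph \<Rightarrow> ('c,'d) pre_digraph \<Rightarrow> bool" where
  "contains_copy D H \<longleftrightarrow> (\<exists>H'. subgraph H' D \<and> digraph_iso H H')"

lemma digirth_ge_iff: "enat k \<le> digirth D \<longleftrightarrow> (\<forall>p. pre_digraph.cycle D p \<longrightarrow> k \<le> length p)"
  by (auto simp: digirth_def le_INF_iff)

lemma digirth_acyclic: "(\<And>p. \<not> pre_digraph.cycle D p) \<Longrightarrow> digirth D = \<infinity>"
  by (simp add: digirth_def top_enat_def)

lemma min_out_degree_ge_iff:
  assumes "fin_digraph D" "verts D \<noteq> {}"
  shows "k \<le> min_out_degree D \<longleftrightarrow> (\<forall>v \<in> verts D. k \<le> out_degree D v)"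
  using assms by (simp add: min_out_degree_def fin_digraph.finite_verts)

lemma digraph_out_spider2: "digraph (out_spider2 l)"
proof -
  have "arcs (out_spider2 l) \<subseteq> {- int l..int l} \<times> {- int l..int l}"
    by (auto simp: out_spider2_def)
  then have "finite (arcs (out_spider2 l))"
    using finite_subset by blast
  then show ?thesis
    by unfold_locales (auto simp: out_spider2_def arc_to_ends_def)
qed

text \<open>The definition indeed describes two directed paths of length \<open>l\<close> sharing only their initial vertex.\<close>

lemma out_spider2_paths:
  fixes l :: nat
  defines "p \<equiv> map (\<lambda>i. (int i, int i + 1)) [0..<l]"
    and "q \<equiv> map (\<lambda>i. (- int i, - (int i + 1))) [0..<l]"
    and "S \<equiv> out_spider2 l"
  shows "pre_digraph.apath S 0 p (int l)" "length p = l"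
    and "pre_digraph.apath S 0 q (- int l)" "length q = l"
    and "set (pre_digraph.awalk_verts S 0 p) \<inter> set (pre_digraph.awalk_verts S 0 q) = {0}"
    and "set (pre_digraph.awalk_verts S 0 p) \<union> set (pre_digraph.awalk_verts S 0 q) = verts S"
    and "set p \<union> set q = arcs S"
proof -
  have S: "tail S = fst" "head S = snd" "verts S = {- int l..int l}"
    by (simp_all add: S_def out_spider2_def)
  have cas_app: "pre_digraph.cas S u (xs @ [e]) v \<longleftrightarrow> pre_digraph.cas S u xs (fst e) \<and> v = snd e"
    for u v :: int and xs e
    by (induction xs arbitrary: u) (auto simp: pre_digraph.cas.simps S)
  have casp: "pre_digraph.cas S 0 (map (\<lambda>i. (int i, int i + 1)) [0..<n]) (int n)" for n
    by (induction n) (auto simp: pre_digraph.cas.simps cas_app)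
  have casq: "pre_digraph.cas S 0 (map (\<lambda>i. (- int i, - (int i + 1))) [0..<n]) (- int n)" for n
    by (induction n) (auto simp: pre_digraph.cas.simps cas_app)
  have vp: "pre_digraph.awalk_verts S 0 p = map int [0..<Suc l]"
    by (cases l) (auto simp: p_def pre_digraph.awalk_verts_conv S o_def)
  have vq: "pre_digraph.awalk_verts S 0 q = map (\<lambda>i. - int i) [0..<Suc l]"
    by (cases l) (auto simp: q_def pre_digraph.awalk_verts_conv S o_def)
  have sp: "set p = {(i, i + 1) | i. 0 \<le> i \<and> i < int l}"
  proof -
    have "set p = (\<lambda>i. (i, i + 1)) ` int ` {0..<l}" by (auto simp: p_def)
    also have "int ` {0..<l} = {0..<int l}" by (simp add: image_int_atLeastLessThan)
    finally show ?thesis by auto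
  qed
  have sq: "set q = {(- i, - (i + 1)) | i. 0 \<le> i \<and> i < int l}"
  proof -
    have "set q = (\<lambda>i. (- i, - (i + 1))) ` int ` {0..<l}" by (auto simp: q_def)
    also have "int ` {0..<l} = {0..<int l}" by (simp add: image_int_atLeastLessThan)
    finally show ?thesis by auto
  qed
  show arcs: "set p \<union> set q = arcs S"
    by (simp add: sp sq S_def out_spider2_def)
  show "length p = l" "length q = l" by (simp_all add: p_def q_def)
  show "pre_digraph.apath S 0 p (int l)"
    using arcs casp[of l, folded p_def] by (auto simp: pre_digraph.apath_def pre_digraph.awalk_def vp S distinct_map)
  show "pre_digraph.apath S 0 q (- int l)"
    using arcs casq[of l, folded q_def] by (auto simp: pre_digraph.apath_def pre_digraph.awalk_def vq S distinct_map inj_on_def)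
  show "set (pre_digraph.awalk_verts S 0 p) \<inter> set (pre_digraph.awalk_verts S 0 q) = {0}"
    unfolding vp vq set_map set_upt by force
  have "x \<in> int ` {0..<Suc l} \<union> (\<lambda>i. - int i) ` {0..<Suc l}" if "x \<in> {- int l..int l}" for x
  proof (cases "0 \<le> x")
    case True
    then have "x = int (nat x)" "nat x < Suc l" using that by auto
    then show ?thesis by (metis UnI1 atLeastLessThan_iff imageI zero_le)
  next
    case False
    then have "x = - int (nat (- x))" "nat (- x) < Suc l" using that by auto
    then show ?thesis by (metis (mono_tags, lifting) UnI2 atLeastLessThan_iff image_eqI zero_le)
  qed
  then have "{- int l..int l} \<subseteq> int ` {0..<Suc l} \<union> (\<lambda>i. - int i) ` {0..<Suc l}"
    by (rule subsetI)
  moreover have "int ` {0..<Suc l} \<union> (\<lambda>i. - int i) ` {0..<Suc l} \<subseteq> {- int l..int l}"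
    by auto
  ultimately show "set (pre_digraph.awalk_verts S 0 p) \<union> set (pre_digraph.awalk_verts S 0 q) = verts S"
    unfolding vp vq S set_map set_upt by (rule subset_antisym[rotated])
qed

end

theory Submission
  imports Defs
begin

text \<open>
  Every walk from \<open>v\<close> to a vertex at distance at least \<open>l\<close> has at least \<open>l\<close> arcs, and the girth makes its
  initial segment of \<open>l\<close> arcs a path. Hence, by Menger's theorem, if there is no spider, every vertex \<open>u\<close> has a
  cut vertex \<open>f u\<close> that meets all walks from the out-neighbours of \<open>u\<close> to vertices at distance at
  least \<open>l\<close> from \<open>u\<close>. The set \<open>R u\<close> of vertices reachable from \<open>u\<close> by nonempty walks avoiding \<open>f u\<close> then lies within
  distance \<open>l - 1\<close> of \<open>u\<close>, so by the girth it contains no in-neighbour of \<open>u\<close>, and arcs leave it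
  only to \<open>f u\<close>.

  In a minimal nonempty set closed under out-neighbours choose \<open>v\<close> with \<open>R v\<close> smallest, put
  \<open>x = f v\<close>, and let \<open>C\<close> be a minimal nonempty subset of \<open>R v\<close> that arcs leave only to \<open>x\<close>. For
  \<open>u\<close> in \<open>C\<close>, the vertex \<open>f u\<close> lies in \<open>C\<close> (otherwise \<open>C = C \<inter> R u\<close> contains \<open>u\<close>), and \<open>x\<close>
  lies in \<open>R u\<close> (otherwise \<open>R u\<close> is smaller than \<open>R v\<close>). A path from \<open>x\<close> to its first vertex \<open>u\<close> in \<open>C\<close>
  avoids \<open>f u\<close> before reaching \<open>u\<close>, which puts an in-neighbour of \<open>u\<close> into \<open>R u\<close>, a contradiction.
\<close>

section \<open>Two disjoint walks\<close>

text \<open>Walks are lists of vertices, possibly with repetitions, and a single vertex in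
  \<open>A\<close> and \<open>B\<close> counts. Simplicity of paths is recovered later from the
  girth.\<close>

definition walk :: "('a \<times> 'a) set \<Rightarrow> 'a set \<Rightarrow> 'a set \<Rightarrow> 'a list \<Rightarrow> bool" where
  "walk E A B p \<longleftrightarrow> p \<noteq> [] \<and> hd p \<in> A \<and> last p \<in> B \<and> successively (\<lambda>a b. (a, b) \<in> E) p"

lemma walk_rev: "walk (E\<inverse>) B A (rev p) \<longleftrightarrow> walk E A B p"
  by (auto simp: walk_def hd_rev last_rev)

lemma walk_mono: "walk E A B p \<Longrightarrow> E \<subseteq> E' \<Longrightarrow> A \<subseteq> A' \<Longrightarrow> B \<subseteq> B' \<Longrightarrow> walk E' A' B' p"
  unfolding walk_def by (auto elim: successively_mono)

lemma walk_prefix: "walk E A B (p @ z # q) \<Longrightarrow> walk E A {z} (p @ [z])"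
  by (cases "p = []") (auto simp: walk_def successively_append_iff)

lemma walk_suffix: "walk E A B (p @ z # q) \<Longrightarrow> walk E {z} B (z # q)"
  by (auto simp: walk_def successively_append_iff)

lemma walk_append:
  assumes "walk E A C p" "walk E D B q" "(last p, hd q) \<in> E"
  shows "walk E A B (p @ q)"
  using assms by (auto simp: walk_def successively_append_iff)

lemma walk_join:
  assumes "walk E A C (p @ [z])" "walk E D B (z # q)"
  shows "walk E A B (p @ z # q)"
  using assms by (cases "p = []") (auto simp: walk_def successively_append_iff)

lemma walk_splice:
  assumes "walk E A C p" "walk E D B q" "z \<in> set p" "z \<in> set q"
  obtains r where "walk E A B r" "set r \<subseteq> set p \<union> set q"
proof -
  obtain p1 p2 where p: "p = p1 @ z # p2" using assms(3) by (meson split_list)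
  obtain q1 q2 where q: "q = q1 @ z # q2" using assms(4) by (meson split_list)
  have "walk E A B (p1 @ z # q2)"
    using walk_join[OF walk_prefix walk_suffix, of E A C p1 z p2 D B q1 q2] assms(1,2)
    by (simp add: p q)
  then show thesis by (rule that) (auto simp: p q)
qed

text \<open>Cut \<open>p\<close> at its first vertex in \<open>{s, x}\<close>: the initial segment
  cannot use the arc \<open>(x, y)\<close>, which would need \<open>x\<close> earlier. If there were
  no such vertex, \<open>p\<close> itself would contradict \<open>sep\<close>.\<close>

lemma walk_to_separator:
  assumes sep: "\<And>p. walk (E - {(x, y)}) A B p \<Longrightarrow> s \<in> set p"
    and p: "walk E A B p" "z \<notin> set p"
  shows "\<exists>q. walk (E - {(x, y)}) A {s, x} q \<and> z \<notin> set q"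
proof -
  have "\<exists>h \<in> set p. h \<in> {s, x}"
  proof (rule ccontr)
    assume n: "\<not> (\<exists>h \<in> set p. h \<in> {s, x})"
    then have "walk (E - {(x, y)}) A B p"
      using p(1) by (auto simp: walk_def elim!: successively_mono)
    then show False using sep n by blast
  qed
  then obtain q h r where p_eq: "p = q @ h # r" and h: "h \<in> {s, x}" and q: "\<forall>a \<in> set q. a \<notin> {s, x}"
    by (auto dest!: split_list_first_prop)
  have w: "walk E A {h} (q @ [h])" using p(1) unfolding p_eq by (rule walk_prefix)
  then have "successively (\<lambda>a b. (a, b) \<in> E) q" by (auto simp: walk_def successively_append_iff)
  then have "successively (\<lambda>a b. (a, b) \<in> E - {(x, y)}) q"
    by (rule successively_mono) (use q in auto)
  moreover have "(last q, h) \<in> E - {(x, y)}" if "q \<noteq> []"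
    using w q that last_in_set[OF that] by (auto simp: walk_def successively_append_iff)
  ultimately have "walk (E - {(x, y)}) A {s, x} (q @ [h])"
    using w h by (auto simp: walk_def successively_append_iff)
  then show ?thesis using p(2) by (intro exI[of _ "q @ [h]"]) (auto simp: p_eq)
qed

text \<open>The mirror image of \<open>walk_to_separator\<close>, obtained by reversing all
  arcs.\<close>

lemma walk_from_separator:
  assumes sep: "\<And>p. walk (E - {(x, y)}) A B p \<Longrightarrow> s \<in> set p"
    and p: "walk E A B p" "z \<notin> set p"
  shows "\<exists>q. walk (E - {(x, y)}) {s, y} B q \<and> z \<notin> set q"
proof -
  have conv: "E\<inverse> - {(y, x)} = (E - {(x, y)})\<inverse>" by auto
  have "\<exists>q. walk (E\<inverse> - {(y, x)}) B {s, y} q \<and> z \<notin> set q"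
  proof (rule walk_to_separator)
    fix p assume "walk (E\<inverse> - {(y, x)}) B A p"
    then have "walk (E - {(x, y)}) A B (rev p)"
      unfolding conv by (metis rev_rev_ident walk_rev)
    then show "s \<in> set p" using sep by fastforce
  next
    show "walk (E\<inverse>) B A (rev p)" using p(1) by (simp add: walk_rev)
    show "z \<notin> set (rev p)" using p(2) by simp
  qed
  then obtain q where q: "walk ((E - {(x, y)})\<inverse>) B {s, y} q" "z \<notin> set q"
    unfolding conv by blast
  then have "walk (E - {(x, y)}) {s, y} B (rev q)"
    by (metis rev_rev_ident walk_rev)
  then show ?thesis using q(2) by (intro exI[of _ "rev q"]) auto
qed

text \<open>
  Menger's theorem for two walks, by Goering's induction on the arcs: if deleting the arc
  \<open>(x, y)\<close> creates a separating vertex \<open>s\<close>, join two disjoint walks into \<open>{s, x}\<close> to two disjoint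
  walks out of \<open>{s, y}\<close>.
\<close>

theorem menger_two:
  assumes "finite E" and "\<And>z. \<exists>p. walk E A B p \<and> z \<notin> set p"
  shows "\<exists>p q. walk E A B p \<and> walk E A B q \<and> set p \<inter> set q = {}"
  using assms
proof (induction E arbitrary: A B rule: finite_psubset_induct)
  case (psubset E)
  show ?case
  proof (cases "E = {}")
    case True
    \<comment> \<open>Without arcs, a walk that avoids the only vertex of another walk is disjoint
      from it.\<close>
    have single: "\<exists>a. p = [a]" if "walk E A B p" for p
      using that True by (cases p; cases "tl p") (auto simp: walk_def)
    obtain p where p: "walk E A B p" using psubset.prems by blast
    then obtain a where a: "p = [a]" using single by blast
    obtain q where q: "walk E A B q" "a \<notin> set q" using psubset.prems by blast
    then show ?thesis using p a by (intro exI[of _ "[a]"] exI[of _ q]) auto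
  next
    case False
    then obtain x y where xy: "(x, y) \<in> E" by auto
    define E' where "E' = E - {(x, y)}"
    have E': "E' \<subset> E" using xy by (auto simp: E'_def)
    have up: "walk E A B p" if "walk E' A B p" for p A B
      using that E' by (auto intro: walk_mono)
    show ?thesis
    proof (cases "\<forall>z. \<exists>p. walk E' A B p \<and> z \<notin> set p")
      case True
      then show ?thesis using psubset.IH[OF E', of A B] up by blast
    next
      case False
      then obtain s where sep: "s \<in> set p" if "walk E' A B p" for p by blast
      have "\<exists>p. walk E' A {s, x} p \<and> z \<notin> set p" for z
        using psubset.prems walk_to_separator sep unfolding E'_def by metis
      then obtain p1 p2 where "walk E' A {s, x} p1" "walk E' A {s, x} p2" "set p1 \<inter> set p2 = {}"
        using psubset.IH[OF E', of A "{s, x}"] by blast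
      \<comment> \<open>One walk thus ends in \<open>s\<close> and the other in \<open>x\<close>;
        this also rules out \<open>s = x\<close>.\<close>
      moreover from this have "last p1 \<noteq> last p2"
        by (metis disjoint_iff last_in_set walk_def)
      ultimately obtain P1 P2 where P: "walk E' A {s} P1" "walk E' A {x} P2" "set P1 \<inter> set P2 = {}"
        unfolding walk_def by (metis inf_commute insert_iff singletonD)
      have "\<exists>p. walk E' {s, y} B p \<and> z \<notin> set p" for z
        using psubset.prems walk_from_separator sep unfolding E'_def by metis
      then obtain q1 q2 where "walk E' {s, y} B q1" "walk E' {s, y} B q2" "set q1 \<inter> set q2 = {}"
        using psubset.IH[OF E', of "{s, y}" B] by blast
      moreover from this have "hd q1 \<noteq> hd q2"
        by (metis disjoint_iff hd_in_set walk_def)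
      ultimately obtain Q1 Q2 where Q: "walk E' {s} B Q1" "walk E' {y} B Q2" "set Q1 \<inter> set Q2 = {}"
        unfolding walk_def by (metis inf_commute insert_iff singletonD)
      have "s \<in> set P1" "s \<in> set Q1" using P(1) Q(1) unfolding walk_def by (metis hd_in_set last_in_set singletonD)+
      \<comment> \<open>Walks may revisit \<open>s\<close>. Cutting at its first occurrence in
        \<open>P1\<close> and its last in \<open>Q1\<close> leaves \<open>xs\<close> and
        \<open>ys\<close> free of \<open>s\<close>.\<close>
      then obtain xs zs ws ys where P1: "P1 = xs @ s # zs" "s \<notin> set xs"
        and Q1: "Q1 = ws @ s # ys" "s \<notin> set ys"
        by (meson split_list_first split_list_last)
      have s: "s \<notin> set P2" "s \<notin> set Q2" using P(3) Q(3) P1 Q1 by auto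
      have wxs: "walk E' A {s} (xs @ [s])" and wys: "walk E' {s} B (s # ys)"
        using P(1) Q(1) unfolding P1 Q1 by (auto intro: walk_prefix walk_suffix)
      \<comment> \<open>Two such walks that meet would splice to a walk from \<open>A\<close> to
        \<open>B\<close> in \<open>E'\<close> that misses the separator.\<close>
      have avoid: False if "walk E' A C p" "walk E' D B q" "z \<in> set p" "z \<in> set q"
        "s \<notin> set p" "s \<notin> set q" for C D p q z
        using walk_splice[OF that(1-4)] sep that(5,6) by blast
      have "set P2 \<inter> set ys = {}"
      proof (rule ccontr)
        assume "set P2 \<inter> set ys \<noteq> {}"
        then obtain z where z: "z \<in> set P2" "z \<in> set ys" by blast
        then have "walk E' UNIV B ys"
          using wys by (cases ys) (auto simp: walk_def)
        then show False using avoid P(2) z s Q1 by blast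
      qed
      moreover have "set xs \<inter> set Q2 = {}"
      proof (rule ccontr)
        assume "set xs \<inter> set Q2 \<noteq> {}"
        then obtain z where z: "z \<in> set xs" "z \<in> set Q2" by blast
        then have "walk E' A UNIV xs"
          using wxs by (cases "xs = []") (auto simp: walk_def successively_append_iff)
        then show False using avoid Q(2) z s P1 by blast
      qed
      ultimately have "set (xs @ s # ys) \<inter> set (P2 @ Q2) = {}"
        using P(3) Q(3) P1 Q1 s by auto
      moreover have "walk E A B (xs @ s # ys)"
        using walk_join[OF wxs wys] by (rule up)
      \<comment> \<open>This walk crosses the deleted arc \<open>(x, y)\<close>.\<close>
      moreover have "walk E A B (P2 @ Q2)"
        using walk_append[OF up[OF P(2)] up[OF Q(2)]] P(2) Q(2) xy by (auto simp: walk_def)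
      ultimately show ?thesis by blast
    qed
  qed
qed

section \<open>The spider\<close>

lemma successively_relpow:
  assumes "successively (\<lambda>a b. (a, b) \<in> E) xs" "i \<le> j" "j < length xs"
  shows "(xs ! i, xs ! j) \<in> E ^^ (j - i)"
  using assms(2,3)
proof (induction j rule: dec_induct)
  case (step n)
  then show ?case using successively_nth[OF assms(1), of n] by (auto simp: Suc_diff_le)
qed simp

text \<open>A repeated vertex would close a walk of at most \<open>l\<close> arcs, since
  \<open>Suc l\<close> vertices span \<open>l\<close> arcs.\<close>

lemma walk_distinct:
  assumes "successively (\<lambda>a b. (a, b) \<in> E) xs" "length xs \<le> Suc l"
    and "\<And>u k. 0 < k \<Longrightarrow> k \<le> l \<Longrightarrow> (u, u) \<notin> E ^^ k"
  shows "distinct xs"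
proof -
  have "xs ! i \<noteq> xs ! j" if "i < j" "j < length xs" for i j
  proof
    assume "xs ! i = xs ! j"
    then have "(xs ! i, xs ! i) \<in> E ^^ (j - i)"
      using successively_relpow[OF assms(1), of i j] that by simp
    moreover have "0 < j - i" "j - i \<le> l" using that assms(2) by auto
    ultimately show False using assms(3) by blast
  qed
  then show ?thesis unfolding distinct_conv_nth by (metis nat_neq_iff)
qed

lemma rtrancl_first_entry:
  assumes "(x, c) \<in> E\<^sup>*" "x \<notin> C" "c \<in> C"
  obtains w u where "(x, w) \<in> (E \<inter> UNIV \<times> (- C))\<^sup>*" "(w, u) \<in> E" "u \<in> C"
proof -
  have "(x, c) \<in> (E \<inter> UNIV \<times> (- C))\<^sup>* \<or>
      (\<exists>w u. (x, w) \<in> (E \<inter> UNIV \<times> (- C))\<^sup>* \<and> (w, u) \<in> E \<and> u \<in> C)"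
    using assms(1)
  proof induction
    case (step y z)
    then show ?case by (cases "z \<in> C") (auto intro: rtrancl.rtrancl_into_rtrancl)
  qed simp
  moreover have "(x, c) \<notin> (E \<inter> UNIV \<times> (- C))\<^sup>*"
    using assms(2,3) by (auto elim: rtranclE)
  ultimately show thesis using that by blast
qed

lemma finite_minimal_set:
  assumes "finite S" "P S"
  obtains M where "M \<subseteq> S" "P M" "\<And>X. X \<subseteq> M \<Longrightarrow> P X \<Longrightarrow> X = M"
proof -
  have "finite {X. X \<subseteq> S \<and> P X}" "{X. X \<subseteq> S \<and> P X} \<noteq> {}"
    using assms by (auto intro: finite_subset[of _ "Pow S"])
  then obtain M where M: "M \<in> {X. X \<subseteq> S \<and> P X}"
    "\<And>X. X \<in> {X. X \<subseteq> S \<and> P X} \<Longrightarrow> X \<subseteq> M \<Longrightarrow> M = X"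
    by (metis finite_has_minimal)
  show thesis
    by (rule that[of M]) (use M in \<open>blast+\<close>)
qed

text \<open>The combinatorial core, free of distances: the girth enters only through
  \<open>pred\<close> and \<open>loop\<close>. \<open>R\<close> restricts only the heads of arcs, so
  \<open>f u = u\<close> is allowed.\<close>

lemma no_cut_vertex_function:
  fixes E :: "('a \<times> 'a) set" and f :: "'a \<Rightarrow> 'a"
  defines "R u \<equiv> (E \<inter> UNIV \<times> (- {f u}))\<^sup>+ `` {u}"
  assumes "finite V" "V \<noteq> {}" "E \<subseteq> V \<times> V"
    and deg: "\<And>u z. u \<in> V \<Longrightarrow> \<exists>w. (u, w) \<in> E \<and> w \<noteq> z"
    and pred: "\<And>u w. u \<in> V \<Longrightarrow> w \<in> R u \<Longrightarrow> (w, u) \<notin> E"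
    and loop: "\<And>u. (u, u) \<notin> E"
  shows False
proof -
  have step: "b \<in> R u" if "a = u \<or> a \<in> R u" "(a, b) \<in> E" "b \<noteq> f u" for a b u
    using that unfolding R_def by (auto intro: trancl_into_trancl)
  have cut: "f u \<notin> R u" for u
    unfolding R_def by (auto elim: tranclE)
  have self: "u \<notin> R u" if "u \<in> V" for u
  proof
    assume "u \<in> R u"
    then obtain w where "w = u \<or> w \<in> R u" "(w, u) \<in> E"
      unfolding R_def by (auto elim: tranclE)
    then show False using pred loop that by blast
  qed
  \<comment> \<open>A walk counted by \<open>R u\<close> could leave \<open>X\<close> only through
    \<open>z\<close>, which is impossible if \<open>z\<close> is in \<open>X\<close> or outside
    \<open>R u\<close>. Used for \<open>X = M\<close>, and for \<open>X = C\<close> with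
    \<open>z = x\<close>.\<close>
  have R_closed: "R u \<subseteq> X" if "E `` X \<subseteq> X \<union> {z}" "z \<in> X \<or> z \<notin> R u" "u \<in> X" for u z X
  proof
    fix w assume "w \<in> R u"
    then have "(u, w) \<in> (E \<inter> UNIV \<times> (- {f u}))\<^sup>+" by (simp add: R_def)
    then have "w \<in> X \<and> w \<in> R u"
    proof induction
      case (base y)
      then have "y \<in> R u" by (auto simp: R_def)
      then show ?case using base that by blast
    next
      case (step y z')
      then have "z' \<in> R u" by (auto simp: R_def intro: trancl_into_trancl)
      then show ?case using step that by blast
    qed
    then show "w \<in> X" ..
  qed
  have "V \<noteq> {} \<and> E `` V \<subseteq> V" using assms(3,4) by blast
  then obtain M where "M \<subseteq> V" "M \<noteq> {} \<and> E `` M \<subseteq> M"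
    and M_min: "\<And>X. X \<subseteq> M \<Longrightarrow> X \<noteq> {} \<and> E `` X \<subseteq> X \<Longrightarrow> X = M"
    by (rule finite_minimal_set[where P = "\<lambda>X. X \<noteq> {} \<and> E `` X \<subseteq> X", OF \<open>finite V\<close>]) (rule that)
  then have M: "M \<subseteq> V" "M \<noteq> {}" "E `` M \<subseteq> M" by simp_all
  obtain v where v: "v \<in> M" and v_min: "\<And>u. u \<in> M \<Longrightarrow> card (R v) \<le> card (R u)"
    using ex_has_least_nat[of "\<lambda>u. u \<in> M" _ "\<lambda>u. card (R u)"] M(2) by blast
  define x where "x = f v"
  have RM: "R v \<subseteq> M" using R_closed[of M v v] M v by blast
  have fin: "finite (R v)" using RM M(1) assms(2) by (meson finite_subset)
  have "R v \<noteq> {}" using deg[of v x] step[of v v] v M x_def by blast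
  moreover have "E `` R v \<subseteq> R v \<union> {x}" using step unfolding x_def by blast
  ultimately have "R v \<noteq> {} \<and> E `` R v \<subseteq> R v \<union> {x}" ..
  then obtain C where "C \<subseteq> R v" "C \<noteq> {} \<and> E `` C \<subseteq> C \<union> {x}"
    and C_min: "\<And>X. X \<subseteq> C \<Longrightarrow> X \<noteq> {} \<and> E `` X \<subseteq> X \<union> {x} \<Longrightarrow> X = C"
    by (rule finite_minimal_set[where P = "\<lambda>X. X \<noteq> {} \<and> E `` X \<subseteq> X \<union> {x}", OF fin]) (rule that)
  then have C: "C \<subseteq> R v" "C \<noteq> {}" "E `` C \<subseteq> C \<union> {x}" by simp_all
  have CM: "C \<subseteq> M" and xC: "x \<notin> C" using C(1) RM cut x_def by blast+
  have fC: "f u \<in> C" if u: "u \<in> C" for u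
  proof (rule ccontr)
    assume n: "f u \<notin> C"
    have inner: "b \<in> C \<inter> R u" if "a = u \<or> a \<in> R u" "(a, b) \<in> E" "b \<in> C" for a b
      using step[OF that(1,2)] that(3) n by blast
    \<comment> \<open>The second out-neighbour makes \<open>C \<inter> R u\<close> nonempty, so that
      minimality of \<open>C\<close> applies.\<close>
    obtain w where "(u, w) \<in> E" "w \<noteq> x" using deg u CM M(1) by blast
    then have "w \<in> C \<inter> R u" using inner C(3) u by blast
    then have "C \<inter> R u = C" using inner C(3) by (intro C_min) blast+
    then show False using self u CM M(1) by blast
  qed
  have xR: "x \<in> R u" if u: "u \<in> C" for u
  proof (rule ccontr)
    assume "x \<notin> R u"
    then have "R u \<subseteq> C" using R_closed C(3) u by blast
    \<comment> \<open>The inclusion is strict because \<open>f u\<close> lies in \<open>C\<close>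
      but not in \<open>R u\<close>.\<close>
    then have "R u \<subset> R v" using fC[OF u] cut[of u] C(1) by blast
    then have "card (R u) < card (R v)" by (rule psubset_card_mono[OF fin])
    moreover have "u \<in> M" using u CM by (rule subsetD[rotated])
    ultimately show False using v_min[of u] by simp
  qed
  have "x \<in> M"
  proof (rule ccontr)
    assume "x \<notin> M"
    then have "E `` C \<subseteq> C" using C(3) CM M(3) by blast
    then have "C = M" using M_min C(2) CM by blast
    then show False using v C(1) self M(1) by blast
  qed
  \<comment> \<open>By minimality of \<open>M\<close>, the vertex \<open>x\<close> reaches all of
    \<open>M\<close>, in particular \<open>C\<close>.\<close>
  define X where "X = E\<^sup>* `` {x}"
  have "X \<subseteq> M"
    using Image_mono[of "E\<^sup>*" "E\<^sup>*" "{x}" M] Image_closed_trancl[OF M(3)] \<open>x \<in> M\<close>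
    unfolding X_def by simp
  moreover have "E `` X \<subseteq> X" "x \<in> X" unfolding X_def by (auto intro: rtrancl_into_rtrancl)
  ultimately have "X = M" by (intro M_min) auto
  then obtain c where "c \<in> C" "(x, c) \<in> E\<^sup>*" using C(2) CM X_def by blast
  then obtain w u where w: "(x, w) \<in> (E \<inter> UNIV \<times> (- C))\<^sup>*" "(w, u) \<in> E" "u \<in> C"
    using rtrancl_first_entry xC by metis
  \<comment> \<open>After \<open>x\<close> this walk stays outside \<open>C\<close>, hence misses
    \<open>f u\<close>; it extends a walk from \<open>u\<close> to \<open>x\<close> within
    \<open>R u\<close>.\<close>
  have "(x, w) \<in> (E \<inter> UNIV \<times> (- {f u}))\<^sup>*"
    using w(1) by (rule rtrancl_mono[THEN subsetD, rotated]) (use fC[OF w(3)] in blast)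
  then have "w \<in> R u" using xR[OF w(3)] unfolding R_def by auto
  then show False using pred w(2,3) CM M(1) by blast
qed

section \<open>Long disjoint walks from a common vertex\<close>

lemma trancl_imp_walk:
  assumes "(u, w) \<in> (E \<inter> UNIV \<times> (- {z}))\<^sup>+"
  obtains p where "walk E (E `` {u}) {w} p" "z \<notin> set p"
proof -
  have "\<exists>p. walk E (E `` {u}) {w} p \<and> z \<notin> set p"
    using assms
  proof induction
    case (base y)
    then show ?case by (intro exI[of _ "[y]"]) (auto simp: walk_def)
  next
    case (step y y')
    then obtain p where "walk E (E `` {u}) {y} p" "z \<notin> set p" by blast
    then show ?case using step.hyps
      by (intro exI[of _ "p @ [y']"]) (auto simp: walk_def successively_append_iff)
  qed
  then show thesis using that by blast
qed

text \<open>The arc from \<open>u\<close> to \<open>hd p\<close> makes the number of arcs equal to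
  the number of vertices of \<open>p\<close>.\<close>

lemma walk_imp_relpow:
  assumes "walk E (E `` {u}) B p"
  shows "(u, last p) \<in> E ^^ length p"
proof -
  have "successively (\<lambda>a b. (a, b) \<in> E) (u # p)" "p \<noteq> []"
    using assms by (auto simp: walk_def successively_Cons)
  then show ?thesis using successively_relpow[of E "u # p" 0 "length p"] by (simp add: last_conv_nth nth_Cons')
qed

lemma ex_disjoint_walks:
  fixes E :: "('a \<times> 'a) set"
  assumes V: "finite V" "V \<noteq> {}" "E \<subseteq> V \<times> V"
    and deg: "\<And>u z. u \<in> V \<Longrightarrow> \<exists>w. (u, w) \<in> E \<and> w \<noteq> z"
    and girth: "\<And>u k. 0 < k \<Longrightarrow> k \<le> l \<Longrightarrow> (u, u) \<notin> E ^^ k" and "0 < l"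
  obtains v p q where "v \<in> V" "walk E (E `` {v}) V p" "walk E (E `` {v}) V q"
    "l \<le> length p" "l \<le> length q" "set p \<inter> set q = {}"
proof (rule ccontr)
  note spider = that
  assume none: "\<not> thesis"
  \<comment> \<open>The vertices at distance at least \<open>l\<close> from \<open>v\<close>,
    including unreachable ones.\<close>
  define T where "T v = {w \<in> V. \<forall>k < l. (v, w) \<notin> E ^^ k}" for v
  have "\<exists>z. \<forall>p. walk E (E `` {v}) (T v) p \<longrightarrow> z \<in> set p" if "v \<in> V" for v
  proof (rule ccontr)
    assume "\<not> ?thesis"
    moreover have "finite E" using V by (meson finite_SigmaI finite_subset)
    ultimately obtain p q where pq: "walk E (E `` {v}) (T v) p" "walk E (E `` {v}) (T v) q"
      "set p \<inter> set q = {}"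
      using menger_two[of E "E `` {v}" "T v"] by blast
    have "l \<le> length r" if "walk E (E `` {v}) (T v) r" for r
      using walk_imp_relpow[OF that] that by (force simp: walk_def T_def not_less[symmetric])
    then have "l \<le> length p" "l \<le> length q" using pq by blast+
    moreover have "T v \<subseteq> V" by (auto simp: T_def)
    then have "walk E (E `` {v}) V p" "walk E (E `` {v}) V q"
      using pq(1,2) by (auto intro: walk_mono)
    ultimately show False using none spider[of v p q] \<open>v \<in> V\<close> pq(3) by blast
  qed
  then obtain f where f: "f v \<in> set p" if "v \<in> V" "walk E (E `` {v}) (T v) p" for v p
    by metis
  show False
  proof (rule no_cut_vertex_function[of V E f])
    show "(u, u) \<notin> E" for u using girth[of 1 u] \<open>0 < l\<close> by auto
  next
    fix u w assume u: "u \<in> V" and "w \<in> (E \<inter> UNIV \<times> (- {f u}))\<^sup>+ `` {u}"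
    then obtain p where p: "walk E (E `` {u}) {w} p" "f u \<notin> set p"
      using trancl_imp_walk[of u w E "f u"] by blast
    show "(w, u) \<notin> E"
    proof
      assume wu: "(w, u) \<in> E"
      then have "w \<notin> T u" using f[OF u] p by (auto simp: walk_def)
      \<comment> \<open>The arc back to \<open>u\<close> closes a walk of \<open>k + 1\<close> arcs,
        and \<open>k + 1\<close> is at most \<open>l\<close>.\<close>
      then obtain k where "k < l" "(u, w) \<in> E ^^ k" using wu V(3) by (auto simp: T_def)
      then show False using girth[of "Suc k" u] wu by auto
    qed
  qed (use V deg in auto)
qed

section \<open>Transfer to digraphs\<close>

text \<open>A closed walk that is no cycle repeats a vertex even after its first arc is dropped, so
  it contains a strictly shorter closed walk.\<close>

lemma (in wf_digraph) closed_w_imp_short_cycle: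
  assumes "closed_w p"
  obtains c where "cycle c" "length c \<le> length p"
proof -
  have "\<exists>c. cycle c \<and> length c \<le> length p"
    using assms
  proof (induction "length p" arbitrary: p rule: less_induct)
    case less
    then obtain u where u: "awalk u p u" "p \<noteq> []" by (auto simp: closed_w_def)
    show ?case
    proof (cases "distinct (tl (awalk_verts u p))")
      case True
      then show ?thesis using u by (auto simp: cycle_def)
    next
      case False
      then obtain e es where p: "p = e # es" by (cases p) auto
      then have es: "awalk (head G e) es u" "\<not> distinct (awalk_verts (head G e) es)"
        using False u by (auto simp: awalk_Cons_iff)
      obtain q r s where "es = q @ r @ s" "closed_w r"
        using awalk_not_distinct_decomp[OF es] by (auto simp: closed_w_def)
      then show ?thesis using less.hyps[of r] p by force
    qed
  qed
  then show thesis using that by blast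
qed

lemma (in wf_digraph) relpow_imp_awalk:
  assumes "(u, v) \<in> arcs_ends G ^^ k" "u \<in> verts G"
  shows "\<exists>p. awalk u p v \<and> length p = k"
  using assms(1)
proof (induction k arbitrary: v)
  case 0
  then show ?case using assms(2) by (intro exI[of _ "[]"]) (auto simp: awalk_Nil_iff)
next
  case (Suc k)
  then obtain w where w: "(u, w) \<in> arcs_ends G ^^ k" "(w, v) \<in> arcs_ends G" by auto
  obtain p where p: "awalk u p w" "length p = k" using Suc.IH w(1) by blast
  obtain e where e: "e \<in> arcs G" "tail G e = w" "head G e = v"
    using w(2) by (auto simp: arcs_ends_def arc_to_ends_def)
  then have "awalk w [e] v" by (auto simp: awalk_Cons_iff awalk_Nil_iff)
  then show ?case using p by (intro exI[of _ "p @ [e]"]) auto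
qed

lemma (in wf_digraph) digirth_no_closed_relpow:
  assumes "enat k < digirth G" "0 < k"
  shows "(u, u) \<notin> arcs_ends G ^^ k"
proof
  assume uu: "(u, u) \<in> arcs_ends G ^^ k"
  then obtain w where "(u, w) \<in> arcs_ends G"
    using \<open>0 < k\<close> by (metis gr0_conv_Suc relpow_Suc_D2)
  then have "u \<in> verts G" by (auto simp: arcs_ends_def arc_to_ends_def)
  then obtain p where "awalk u p u" "length p = k" using relpow_imp_awalk[OF uu] by blast
  then obtain c where "cycle c" "length c \<le> k"
    using closed_w_imp_short_cycle[of p] \<open>0 < k\<close> by (auto simp: closed_w_def)
  moreover have "enat (Suc k) \<le> digirth G" using assms(1) by (metis Suc_ile_eq)
  ultimately show False by (force simp: digirth_ge_iff)
qed

text \<open>Arcs of \<open>D\<close> are chosen over the images of arcs of \<open>H\<close>; as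
  \<open>H\<close> has no parallel arcs, injectivity on vertices makes this choice
  injective.\<close>

lemma contains_copyI:
  fixes f :: "'c \<Rightarrow> 'a"
  assumes "wf_digraph D" "nomulti_digraph H"
    and inj: "inj_on f (verts H)" and verts: "f ` verts H \<subseteq> verts D"
    and arcs: "\<And>a. a \<in> arcs H \<Longrightarrow> (f (tail H a), f (head H a)) \<in> arcs_ends D"
  shows "contains_copy D H"
proof -
  interpret D: wf_digraph D by fact
  interpret H: nomulti_digraph H by fact
  have "\<forall>a \<in> arcs H. \<exists>e. e \<in> arcs D \<and> tail D e = f (tail H a) \<and> head D e = f (head H a)"
    using arcs by (force simp: arcs_ends_def arc_to_ends_def)
  then obtain g where g: "g a \<in> arcs D" "tail D (g a) = f (tail H a)" "head D (g a) = f (head H a)"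
    if "a \<in> arcs H" for a by metis
  have "inj_on g (arcs H)"
  proof (rule inj_onI)
    fix a b assume ab: "a \<in> arcs H" "b \<in> arcs H" "g a = g b"
    then have "f (tail H a) = f (tail H b)" "f (head H a) = f (head H b)" using g by metis+
    then have "arc_to_ends H a = arc_to_ends H b"
      using inj ab by (auto simp: arc_to_ends_def dest: inj_onD)
    then show "a = b" using H.no_multi_arcs ab by blast
  qed
  \<comment> \<open>Taking \<open>head D\<close> and \<open>tail D\<close> makes the image
    compatible with \<open>D\<close>.\<close>
  define h where "h = \<lparr> iso_verts = f, iso_arcs = g, iso_head = head D, iso_tail = tail D \<rparr>"
  have h: "H.digraph_isomorphism h"
    unfolding H.digraph_isomorphism_def h_def using inj \<open>inj_on g (arcs H)\<close> g H.wf_digraph by simp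
  have "subgraph (app_iso h H) D"
    unfolding subgraph_def compatible_def
    using H.wf_digraphI_app_iso[OF h] verts g D.wf_digraph by (auto simp: h_def)
  then show ?thesis unfolding contains_copy_def digraph_iso_def using h by blast
qed

lemma contains_out_spider2I:
  assumes "wf_digraph D"
    and p: "successively (\<lambda>a b. (a, b) \<in> arcs_ends D) (v # p)" "distinct (v # p)" "length p = l"
    and q: "successively (\<lambda>a b. (a, b) \<in> arcs_ends D) (v # q)" "distinct (v # q)" "length q = l"
    and disj: "set p \<inter> set q = {}" and verts: "set (v # p @ q) \<subseteq> verts D"
  shows "contains_copy D (out_spider2 l)"
proof -
  \<comment> \<open>The two legs agree at index 0, where both give \<open>v\<close>.\<close>
  define f where "f i = (if 0 \<le> i then (v # p) ! nat i else (v # q) ! nat (- i))" for i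
  have fp: "f (int n) = (v # p) ! n" for n by (simp add: f_def)
  have fq: "f (- int n) = (v # q) ! n" for n by (cases "n = 0") (simp_all add: f_def)
  have cases: thesis if "i \<in> {- int l..int l}" "\<And>n. i = int n \<Longrightarrow> n \<le> l \<Longrightarrow> thesis"
    "\<And>n. i = - int n \<Longrightarrow> 0 < n \<Longrightarrow> n \<le> l \<Longrightarrow> thesis" for i thesis
    using that(1) that(2)[of "nat i"] that(3)[of "nat (- i)"] by (cases "0 \<le> i") auto
  have ppeq: "m = n" if "(v # p) ! m = (v # p) ! n" "m \<le> l" "n \<le> l" for m n
    using that nth_eq_iff_index_eq[OF p(2)] p(3) by auto
  have qqeq: "m = n" if "(v # q) ! m = (v # q) ! n" "m \<le> l" "n \<le> l" for m n
    using that nth_eq_iff_index_eq[OF q(2)] q(3) by auto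
  have pq: "(v # p) ! m \<noteq> (v # q) ! n" if "m \<le> l" "0 < n" "n \<le> l" for m n
  proof -
    have "(v # q) ! n \<in> set q" using that q(3) by (auto simp: nth_Cons')
    moreover have "(v # p) ! m \<in> set (v # p)" using that p(3) by (intro nth_mem) auto
    ultimately show ?thesis using disj q(2) by auto
  qed
  have "inj_on f {- int l..int l}"
  proof (rule inj_onI)
    fix i j assume i: "i \<in> {- int l..int l}" and j: "j \<in> {- int l..int l}" and eq: "f i = f j"
    show "i = j"
      by (rule cases[OF i]; rule cases[OF j])
        (use eq ppeq qqeq pq in \<open>simp add: fp fq; metis\<close>)+
  qed
  moreover have "f ` {- int l..int l} \<subseteq> verts D"
  proof
    fix w assume "w \<in> f ` {- int l..int l}"
    then obtain i where i: "i \<in> {- int l..int l}" "w = f i" by blast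
    have "(v # p) ! n \<in> set (v # p)" "(v # q) ! n \<in> set (v # q)" if "n \<le> l" for n
      using that p(3) q(3) by (intro nth_mem; simp)+
    then have "w \<in> set (v # p) \<union> set (v # q)"
      unfolding i(2) using cases[OF i(1)] fp fq by (metis UnI1 UnI2)
    then show "w \<in> verts D" using verts by auto
  qed
  moreover have "(f (fst a), f (snd a)) \<in> arcs_ends D" if a: "a \<in> arcs (out_spider2 l)" for a
  proof -
    consider n where "a = (int n, int (Suc n))" "n < l" | n where "a = (- int n, - int (Suc n))" "n < l"
    proof -
      obtain i where "0 \<le> i" "i < int l" "a = (i, i + 1) \<or> a = (- i, - (i + 1))"
        using a by (auto simp: out_spider2_def)
      then show thesis using that(1)[of "nat i"] that(2)[of "nat i"] by auto
    qed
    then show ?thesis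
      using successively_nth[OF p(1)] successively_nth[OF q(1)] p(3) q(3)
      by cases (simp_all only: fst_conv snd_conv fp fq, simp_all)
  qed
  ultimately show ?thesis
    using digraph_out_spider2[of l] assms(1)
    by (intro contains_copyI[of _ _ f]) (auto simp: out_spider2_def digraph_def)
qed

theorem theorem15:
  fixes D :: "('a,'b) pre_digraph" and l :: nat
  assumes "0 < l"
    and "digraph D" and "verts D \<noteq> {}"
    and "2 \<le> min_out_degree D"
    and "enat (2 * l) \<le> digirth D"
  shows "contains_copy D (out_spider2 l)"
proof -
  interpret digraph D by fact
  define E where "E = arcs_ends D"
  have E: "E \<subseteq> verts D \<times> verts D"
    by (auto simp: E_def arcs_ends_def arc_to_ends_def)
  have arc_E: "(tail D e, head D e) \<in> E" if "e \<in> arcs D" for e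
    using that by (auto simp: E_def arcs_ends_def arc_to_ends_def)
  have girth: "(u, u) \<notin> E ^^ k" if "0 < k" "k \<le> l" for u k
    unfolding E_def
  proof (rule digirth_no_closed_relpow)
    have "enat k < enat (2 * l)" using that \<open>0 < l\<close> by simp
    then show "enat k < digirth D" using assms(5) by (rule less_le_trans)
  qed fact
  have deg: "\<exists>w. (u, w) \<in> E \<and> w \<noteq> z" if "u \<in> verts D" for u z
  proof -
    have "2 \<le> card (out_arcs D u)"
      using assms(3,4) that min_out_degree_ge_iff[OF fin_digraph_axioms]
      by (auto simp: out_degree_def)
    then obtain S where "S \<subseteq> out_arcs D u" "card S = 2"
      by (meson obtain_subset_with_card_n)
    then obtain e e' where e: "e \<in> out_arcs D u" "e' \<in> out_arcs D u" "e \<noteq> e'"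
      by (auto simp: card_2_iff)
    then have "head D e \<noteq> head D e'"
      using no_multi_arcs[of e e'] by (auto simp: arc_to_ends_def)
    moreover have "(u, head D e) \<in> E" "(u, head D e') \<in> E"
      using e arc_E[of e] arc_E[of e'] by simp_all
    ultimately show ?thesis by metis
  qed
  obtain v p q where vpq: "v \<in> verts D" "walk E (E `` {v}) (verts D) p" "walk E (E `` {v}) (verts D) q"
    "l \<le> length p" "l \<le> length q" "set p \<inter> set q = {}"
    using ex_disjoint_walks[of "verts D" E l] E deg girth assms(1,3) by (metis finite_verts)
  \<comment> \<open>Keeping \<open>l\<close> vertices after \<open>v\<close> gives exactly
    \<open>l\<close> arcs, short enough for the girth to make the leg a path that does not return to
    \<open>v\<close>.\<close>
  have leg: "successively (\<lambda>a b. (a, b) \<in> E) (v # take l r)" "distinct (v # take l r)"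
    "length (take l r) = l" "set (take l r) \<subseteq> verts D"
    if r: "walk E (E `` {v}) (verts D) r" "l \<le> length r" for r
  proof -
    have "successively (\<lambda>a b. (a, b) \<in> E) (v # r)"
      using r(1) by (auto simp: walk_def successively_Cons)
    then have "successively (\<lambda>a b. (a, b) \<in> E) (take (Suc l) (v # r))"
      by (metis append_take_drop_id successively_append_iff)
    then show s: "successively (\<lambda>a b. (a, b) \<in> E) (v # take l r)" by simp
    show len: "length (take l r) = l" using r(2) by simp
    show "distinct (v # take l r)" using s len girth by (intro walk_distinct[of E _ l]) auto
    show "set (take l r) \<subseteq> verts D"
    proof
      fix w assume "w \<in> set (take l r)"
      then obtain i where "i < l" "w = take l r ! i" using len by (metis in_set_conv_nth)
      then have "(((v # take l r) ! i), w) \<in> E"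
        using successively_nth[OF s, of i] len by simp
      then show "w \<in> verts D" using E by blast
    qed
  qed
  have "set (take l p) \<inter> set (take l q) = {}"
    using vpq(6) by (meson disjoint_iff in_set_takeD)
  then show ?thesis
    using contains_out_spider2I[OF wf_digraph_axioms, of v "take l p" l "take l q"]
      leg[OF vpq(2,4)] leg[OF vpq(3,5)] vpq(1) unfolding E_def by auto
qed

end
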